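(* Let $\mathbb{H}$ be a real separable Hilbert space and let $Z$ be a centered Gaussian process in $\mathbb{H}$ with covariance operator $C$, i.e. $Z\sim\mathcal{N}(0,C)$. Let $\mathcal{H}\subset\mathbb{H}$ denote the Cameron–Martin space (reproducing kernel Hilbert space) of $Z$, with norm $\|\cdot\|_{\mathcal{H}}$. Let $\mathcal{D}$ be the set of datasets of size $n$, where $D,D'\in\mathcal{D}$ are adjacent ($D\sim D'$) if they differ in exactly one element. Let $h:\mathcal{D}\to\mathbb{H}$ be a summary that is compatible with $Z$, i.e. $h(D)\in\mathcal{H}$ for every $D\in\mathcal{D}$, and suppose its global sensitivity $$\Delta:=\sup_{D\sim D'}\|h(D)-h(D')\|_{\mathcal{H}}$$ is finite. Let $\mu>0$ and $\sigma\geq \Delta/\mu$. Then the mechanism $\tilde h(D)=h(D)+\sigma Z$ is $\mu$-Gaussian differentially private.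
   Context: For probability distributions $U_1,U_2$ on a common space, the trade-off function $T(U_1,U_2):[0,1]\to[0,1]$ is $T(U_1,U_2)(\alpha)=\inf_\zeta\{\beta_\zeta:\alpha_\zeta\le\alpha\}$, where the infimum is over (possibly randomized) rejection rules $\zeta$ for testing $H_0:U_1$ versus $H_1:U_2$, $\alpha_\zeta$ is the type I error and $\beta_\zeta$ the type II error of $\zeta$. Let $G_\mu:=T(N(0,1),N(\mu,1))$. A randomized mechanism $\tilde h$ is $\mu$-Gaussian differentially private ($\mu$-GDP) if for all adjacent datasets $D\sim D'$, $T(\mathrm{Law}(\tilde h(D)),\mathrm{Law}(\tilde h(D')))(\alpha)\ge G_\mu(\alpha)$ for all $\alpha\in[0,1]$. *)

theory Defs
  imports "HOL-Probability.Probability"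
begin

text \<open>Trade-off function T(U1,U2): infimum of type II errors of randomized
  tests phi (measurable, values in [0,1]) whose type I error is at most alpha.\<close>
definition tradeoff :: "'b measure \<Rightarrow> 'b measure \<Rightarrow> real \<Rightarrow> real" where
  "tradeoff U1 U2 \<alpha> = Inf {1 - (\<integral>x. \<phi> x \<partial>U2) | \<phi>.
      \<phi> \<in> borel_measurable U1 \<and> (\<forall>x. 0 \<le> \<phi> x \<and> \<phi> x \<le> 1) \<and> (\<integral>x. \<phi> x \<partial>U1) \<le> \<alpha>}"

definition normal_measure :: "real \<Rightarrow> real measure" where
  "normal_measure m = density lborel (normal_density m 1)"

definition G :: "real \<Rightarrow> real \<Rightarrow> real" where
  "G \<mu> = tradeoff (normal_measure 0) (normal_measure \<mu>)"

definition GDP :: "real \<Rightarrow> ('d \<Rightarrow> 'd \<Rightarrow> bool) \<Rightarrow> ('d \<Rightarrow> 'b measure) \<Rightarrow> bool" where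
  "GDP \<mu> adj mech \<longleftrightarrow> (\<forall>D D'. adj D D' \<longrightarrow>
      (\<forall>\<alpha>\<in>{0..1}. tradeoff (mech D) (mech D') \<alpha> \<ge> G \<mu> \<alpha>))"

definition centered_gaussian_real :: "real measure \<Rightarrow> bool" where
  "centered_gaussian_real L \<longleftrightarrow>
     L = return borel 0 \<or> (\<exists>s>0. L = density lborel (normal_density 0 s))"

definition centered_gaussian_measure :: "'a::{real_inner,polish_space} measure \<Rightarrow> bool" where
  "centered_gaussian_measure N \<longleftrightarrow> prob_space N \<and> sets N = sets borel \<and>
     (\<forall>k. centered_gaussian_real (distr N borel (\<lambda>x. x \<bullet> k)))"

text \<open>Cameron--Martin space and norm of a centered Gaussian measure N
  (Bogachev's definition): |h|_H = sup { <h,k> : E_N <x,k>^2 <= 1 },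
  and h belongs to the Cameron--Martin space iff this supremum is finite.\<close>
definition cm_set :: "'a::{real_inner,polish_space} measure \<Rightarrow> 'a \<Rightarrow> real set" where
  "cm_set N h = {h \<bullet> k | k. (\<integral>x. (x \<bullet> k)\<^sup>2 \<partial>N) \<le> 1}"

definition cameron_martin_space :: "'a::{real_inner,polish_space} measure \<Rightarrow> 'a set" where
  "cameron_martin_space N = {h. bdd_above (cm_set N h)}"

definition cm_norm :: "'a::{real_inner,polish_space} measure \<Rightarrow> 'a \<Rightarrow> real" where
  "cm_norm N h = Sup (cm_set N h)"

definition adjacent :: "nat \<Rightarrow> 'x list \<Rightarrow> 'x list \<Rightarrow> bool" where
  "adjacent n D D' \<longleftrightarrow> length D = n \<and> length D' = n \<and> card {i. i < n \<and> D ! i \<noteq> D' ! i} = 1"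

end

theory Submission
  imports Defs
begin

text \<open>If the Cameron--Martin norm of \<open>d\<close> is at most \<open>\<mu>\<close>, the covariance form of \<open>N\<close> dominates
  \<open>k \<mapsto> (d \<bullet> k)\<^sup>2 / \<mu>\<^sup>2\<close>, so \<open>N\<close> is the law of \<open>(X / \<mu>) d + W\<close> with \<open>X\<close> standard normal and
  independent of \<open>W\<close>. Replacing \<open>X\<close> by \<open>X + \<mu>\<close> shifts this law by \<open>d\<close>: both mechanism outputs
  are obtained from \<open>N(0,1)\<close> and \<open>N(\<mu>,1)\<close> by the same randomized map, and averaging a
  test over \<open>W\<close> yields a test of \<open>N(0,1)\<close> against \<open>N(\<mu>,1)\<close> with the same errors.\<close>

subsection \<open>Uniqueness of measures with a given characteristic functional\<close>

text \<open>The obstacle is the existence of \<open>W\<close>: the reduced form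
  \<open>cov k k - (d \<bullet> k)\<^sup>2 / \<mu>\<^sup>2\<close> must come from an actual measure.
  \<open>W\<close> is made from \<open>N\<close> itself, by subtracting from \<open>x\<close> a
  multiple of \<open>d\<close> proportional to the linear functional that represents
  \<open>d\<close> in L2(\<open>N\<close>). In infinite dimensions this functional need not have the
  form \<open>x \<bullet> k\<close>; it is only an almost sure limit of such functionals, along
  vectors \<open>k n\<close> that nearly attain the Cameron--Martin norm. Laws are compared through
  characteristic functionals, where independence adds exponents, and uniqueness on the Hilbert space
  is reduced to Levy's theorem on the line. If the norm of \<open>d\<close> is below
  \<open>\<mu>\<close>, the slack stays in \<open>W\<close>: \<open>X\<close> keeps the coefficient
  \<open>1 / \<mu>\<close> and the shift is exactly \<open>\<mu>\<close>. Here \<open>d\<close> is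
  the difference of the summaries divided by \<open>\<sigma>\<close>; the case
  \<open>\<sigma> = 0\<close>, where the sensitivity bound forces equal summaries, is treated
  separately.\<close>

lemma finite_measure_eqI_char:
  fixes M1 M2 :: "real measure"
  assumes "finite_measure M1" "finite_measure M2"
    and s1: "sets M1 = sets borel" and s2: "sets M2 = sets borel"
    and ch: "\<And>t. (CLINT x|M1. iexp (t * x)) = (CLINT x|M2. iexp (t * x))"
  shows "M1 = M2"
proof -
  interpret M1: finite_measure M1 by fact
  interpret M2: finite_measure M2 by fact
  define m where "m = measure M1 (space M1)"
  \<comment> \<open>Frequency 0 reads off the total mass. The common mass \<open>m\<close> can then
    be divided out, which reduces the claim to \<open>Levy_uniqueness\<close> for probability
    measures.\<close>
  have m2: "measure M2 (space M2) = m"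
    using ch[of 0] by (simp add: m_def)
  have em1: "emeasure M1 (space M1) = ennreal m" and em2: "emeasure M2 (space M2) = ennreal m"
    using m2 by (simp_all add: m_def M1.emeasure_eq_measure M2.emeasure_eq_measure)
  show ?thesis
  proof (cases "m = 0")
    case True
    have "emeasure M1 A = 0" "emeasure M2 A = 0" for A
      using emeasure_space[of M1 A] emeasure_space[of M2 A] em1 em2 True by auto
    then show ?thesis
      using s1 s2 by (intro measure_eqI) auto
  next
    case False
    then have m: "m > 0"
      by (simp add: m_def less_le)
    have rd: "real_distribution (scale_measure (ennreal (1/m)) N)"
      if "sets N = sets borel" "emeasure N (space N) = ennreal m" for N :: "real measure"
    proof -
      have "prob_space (scale_measure (ennreal (1/m)) N)"
        using that m by (intro prob_spaceI) (simp add: space_scale_measure ennreal_mult[symmetric])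
      then show ?thesis
        using that by (simp add: real_distribution_def real_distribution_axioms_def)
    qed
    have sc: "char (scale_measure (ennreal (1/m)) N) t = (1/m) *\<^sub>R (CLINT x|N. iexp (t * x))"
      if "sets N = sets borel" for N :: "real measure" and t
    proof -
      have "scale_measure (ennreal (1/m)) N = density N (\<lambda>_. ennreal (1/m))"
        using m by (intro measure_eqI) (auto simp: emeasure_density nn_integral_cmult_indicator)
      moreover have "(\<lambda>x. iexp (t * x)) \<in> borel_measurable N"
        unfolding measurable_cong_sets[OF that refl] by measurable
      ultimately show ?thesis
        using m unfolding char_def by (simp add: integral_density)
    qed
    have "scale_measure (ennreal (1/m)) M1 = scale_measure (ennreal (1/m)) M2"
      using rd[OF s1 em1] rd[OF s2 em2]
      by (rule Levy_uniqueness) (auto simp: fun_eq_iff sc s1 s2 ch simp del: of_real_mult)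
    then have "scale_measure (ennreal m) (scale_measure (ennreal (1/m)) M1)
        = scale_measure (ennreal m) (scale_measure (ennreal (1/m)) M2)"
      by simp
    then show ?thesis
      using m by (simp add: scale_scale_measure ennreal_mult[symmetric])
  qed
qed

section \<open>Half-spaces as a generator of the Borel sets\<close>

lemma borel_measurable_inner_right [measurable]:
  "(\<lambda>x::'a::{real_inner,second_countable_topology}. x \<bullet> k) \<in> borel_measurable borel"
  by (intro borel_measurable_continuous_onI continuous_intros)

text \<open>A closed ball is the intersection of its supporting half-spaces, by Cauchy-Schwarz and
  the choice \<open>k = x - c\<close>. Violating one of these inequalities is an open condition on
  \<open>k\<close>, so a countable dense set of directions suffices. Separability then writes an
  open set as a countable union of balls.\<close>

lemma borel_halfspaces:
  "sets (borel :: 'a::{real_inner,second_countable_topology} measure) = sigma_sets UNIV (range (\<lambda>(k,r). {x. x \<bullet> k \<le> r}))"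
    (is "_ = sigma_sets UNIV ?H")
proof
  interpret S: sigma_algebra UNIV "sigma_sets UNIV ?H"
    by (rule sigma_algebra_sigma_sets) simp
  obtain D :: "'a set" where D: "countable D" "\<And>X. open X \<Longrightarrow> X \<noteq> {} \<Longrightarrow> \<exists>d\<in>D. d \<in> X"
    by (rule countable_dense_setE) blast
  have Dne: "D \<noteq> {}" using D(2)[of UNIV] by auto
  have cb: "cball c r \<in> sigma_sets UNIV ?H" if "r \<ge> 0" for c :: 'a and r
  proof -
    have "cball c r = (\<Inter>k\<in>D. {x. x \<bullet> k \<le> r * norm k + c \<bullet> k})"
    proof (intro set_eqI iffI)
      fix x assume "x \<in> cball c r"
      then have *: "norm (x - c) \<le> r" by (simp add: dist_norm norm_minus_commute)
      have "(x - c) \<bullet> k \<le> r * norm k" for k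
        using norm_cauchy_schwarz[of "x - c" k] mult_right_mono[OF * norm_ge_zero[of k]] by linarith
      then show "x \<in> (\<Inter>k\<in>D. {x. x \<bullet> k \<le> r * norm k + c \<bullet> k})"
        by (auto simp: inner_diff_left algebra_simps)
    next
      fix x assume "x \<in> (\<Inter>k\<in>D. {x. x \<bullet> k \<le> r * norm k + c \<bullet> k})"
      then have *: "(x - c) \<bullet> k \<le> r * norm k" if "k \<in> D" for k
        using that by (auto simp: inner_diff_left algebra_simps)
      have "(x - c) \<bullet> k \<le> r * norm k" for k
      proof (rule ccontr)
        assume "\<not> ?thesis"
        then have "k \<in> {k. r * norm k < (x - c) \<bullet> k}" by simp
        moreover have "open {k. r * norm k < (x - c) \<bullet> k}"
          by (intro open_Collect_less continuous_intros)
        ultimately obtain d where "d \<in> D" "r * norm d < (x - c) \<bullet> d"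
          using D(2) by blast
        with * show False by force
      qed
      from this[of "x - c"] have "norm (x - c) * norm (x - c) \<le> r * norm (x - c)"
        by (simp add: dot_square_norm power2_eq_square)
      then have "norm (x - c) \<le> r"
        using that by (cases "norm (x - c) = 0") (auto simp: mult_le_cancel_right)
      then show "x \<in> cball c r"
        by (simp add: dist_norm norm_minus_commute)
    qed
    also have "\<dots> \<in> sigma_sets UNIV ?H"
      using D(1) Dne by (intro S.countable_INT' ) auto
    finally show ?thesis .
  qed
  have "S \<in> sigma_sets UNIV ?H" if S: "open S" for S :: "'a set"
  proof -
    let ?F = "{ball c r | c r. 0 \<le> r \<and> cball c r \<subseteq> S}"
    obtain F where F: "F \<subseteq> ?F" "countable F" "\<Union>F = \<Union>?F"
      by (rule Lindelof[of ?F]) auto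
    \<comment> \<open>Lindelof yields open balls, while only closed balls are known to be generated;
      a closed ball between \<open>B\<close> and \<open>S\<close> can replace \<open>B\<close>
      without changing the union.\<close>
    have "\<exists>C. B \<subseteq> C \<and> C \<subseteq> S \<and> C \<in> sigma_sets UNIV ?H" if B: "B \<in> F" for B
    proof -
      obtain c r where "B = ball c r" "0 \<le> r" "cball c r \<subseteq> S"
        using F(1) B by blast
      then show ?thesis
        using cb[of r c] ball_subset_cball[of c r] by blast
    qed
    then obtain C where C: "\<And>B. B \<in> F \<Longrightarrow> B \<subseteq> C B \<and> C B \<subseteq> S \<and> C B \<in> sigma_sets UNIV ?H"
      by metis
    have "S \<subseteq> \<Union>?F"
    proof
      fix x assume "x \<in> S"
      then obtain e where "e > 0" "cball x e \<subseteq> S"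
        using S open_contains_cball by blast
      then have "ball x e \<in> ?F" "x \<in> ball x e" by (auto intro!: exI[of _ x] exI[of _ e])
      then show "x \<in> \<Union>?F" by blast
    qed
    then have "S = (\<Union>B\<in>F. C B)"
      using C unfolding F(3)[symmetric] by blast
    also have "\<dots> \<in> sigma_sets UNIV ?H"
      using C F(2) by (intro S.countable_UN') auto
    finally show ?thesis .
  qed
  then show "sets (borel :: 'a measure) \<subseteq> sigma_sets UNIV ?H"
    using S.sigma_sets_subset[of "Collect open"] by (auto simp: borel_def)
  have "{x. x \<bullet> k \<le> r} \<in> sets borel" for k :: 'a and r
    by measurable
  then have "?H \<subseteq> sets borel"
    by auto
  then show "sigma_sets UNIV ?H \<subseteq> sets borel"
    using sets.sigma_sets_subset[of ?H borel] by simp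
qed

section \<open>Characteristic functionals restricted to cylinders\<close>

lemma (in finite_measure) integrable_iexp_weight [simp]:
  assumes [measurable]: "w \<in> borel_measurable M" "g \<in> borel_measurable M"
    and w: "\<And>x. 0 \<le> w x" "\<And>x. w x \<le> (C::real)"
  shows "integrable M (\<lambda>x. complex_of_real (w x) * iexp (g x))"
proof (rule integrable_const_bound[of _ C])
  show "AE x in M. norm (complex_of_real (w x) * iexp (g x)) \<le> C"
    using w by (simp add: norm_mult)
qed measurable

text \<open>Modulation by a cosine is a shift of frequency: the transform of the modulated weight at
  \<open>b\<close> only involves that of \<open>w\<close> at \<open>b\<close>, \<open>a + b\<close>
  and \<open>b - a\<close>.\<close>

lemma trig_weight_expand:
  "complex_of_real (w * (2 + cos (a + \<theta>))) * iexp b =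
     2 * (complex_of_real w * iexp b) + (iexp \<theta> / 2) * (complex_of_real w * iexp (a + b))
       + (iexp (- \<theta>) / 2) * (complex_of_real w * iexp (b - a))"
proof -
  have "complex_of_real (cos (a + \<theta>)) = (iexp (a + \<theta>) + iexp (- (a + \<theta>))) / 2"
    by (simp add: cos_of_real[symmetric] cos_exp_eq algebra_simps)
  moreover have iexp_add: "iexp (u + v) = iexp u * iexp v" for u v
    by (simp add: distrib_left exp_add)
  moreover have "iexp (- (a + \<theta>)) = iexp (- a) * iexp (- \<theta>)"
    using iexp_add[of "- a" "- \<theta>"] by simp
  moreover have "iexp (b - a) = iexp b * iexp (- a)"
    using iexp_add[of b "- a"] by simp
  moreover have "w' * (2 + (A * T + A' * T') / 2) * B =
      2 * (w' * B) + T / 2 * (w' * (A * B)) + T' / 2 * (w' * (B * A'))" for w' A A' T T' B :: complex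
    by (simp add: field_simps)
  ultimately show ?thesis
    by (simp only: of_real_mult of_real_add of_real_numeral)
qed

text \<open>Agreement of characteristic functionals survives restriction to a cylinder
  \<open>x \<bullet> k \<in> B\<close>: one-dimensional uniqueness applies to the positive weights
  \<open>2 + cos (x \<bullet> l + \<theta>)\<close>, whose transform along \<open>k\<close> is a combination of values of the
  original functionals.\<close>

lemma charfun_eq_restrict_cylinder:
  fixes P Q :: "'a::{real_inner,second_countable_topology} measure" and w :: "'a \<Rightarrow> real"
  assumes "finite_measure P" "finite_measure Q"
    and sP [measurable_cong]: "sets P = sets borel" and sQ [measurable_cong]: "sets Q = sets borel"
    and w [measurable]: "w \<in> borel_measurable borel" and w0: "\<And>x. 0 \<le> w x" and w1: "\<And>x. w x \<le> 1"
    and eq: "\<And>l. (CLINT x|P. of_real (w x) * iexp (x \<bullet> l)) = (CLINT x|Q. of_real (w x) * iexp (x \<bullet> l))"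
    and B [measurable]: "B \<in> sets borel"
  shows "(CLINT x|P. of_real (w x * indicator B (x \<bullet> k)) * iexp (x \<bullet> l))
    = (CLINT x|Q. of_real (w x * indicator B (x \<bullet> k)) * iexp (x \<bullet> l))"
proof -
  interpret P: finite_measure P by fact
  interpret Q: finite_measure Q by fact
  \<comment> \<open>The 2 makes the weight nonnegative, hence a density. The phases 0 and
    \<open>- pi/2\<close> later produce cosine and sine, that is, real and imaginary parts.\<close>
  let ?u = "\<lambda>l \<theta> x. w x * (2 + cos (x \<bullet> l + \<theta>))"
  have u0: "0 \<le> ?u l \<theta> x" and u3: "?u l \<theta> x \<le> 3" for l \<theta> x
  proof -
    have "0 \<le> 2 + cos (x \<bullet> l + \<theta>)" "2 + cos (x \<bullet> l + \<theta>) \<le> 3"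
      using cos_ge_minus_one[of "x \<bullet> l + \<theta>"] cos_le_one[of "x \<bullet> l + \<theta>"] by linarith+
    then show "0 \<le> ?u l \<theta> x" "?u l \<theta> x \<le> 3"
      using w0[of x] w1[of x] mult_mono[of "w x" 1 "2 + cos (x \<bullet> l + \<theta>)" 3] by auto
  qed
  have ueq: "(CLINT x|P. of_real (?u l \<theta> x) * iexp (x \<bullet> m))
      = (CLINT x|Q. of_real (?u l \<theta> x) * iexp (x \<bullet> m))" for l m \<theta>
  proof -
    have ex: "(CLINT x|R. of_real (?u l \<theta> x) * iexp (x \<bullet> m)) =
        2 * (CLINT x|R. of_real (w x) * iexp (x \<bullet> m))
        + (iexp \<theta> / 2) * (CLINT x|R. of_real (w x) * iexp (x \<bullet> (l + m)))
        + (iexp (- \<theta>) / 2) * (CLINT x|R. of_real (w x) * iexp (x \<bullet> (m - l)))"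
      if "finite_measure R" and R [measurable_cong]: "sets R = sets borel" for R :: "'a measure"
    proof -
      interpret R: finite_measure R by fact
      define g where "g j x = complex_of_real (w x) * iexp (x \<bullet> j)" for j and x :: 'a
      have [simp]: "integrable R (g j)" for j
        using w0 w1 unfolding g_def by (intro R.integrable_iexp_weight[where C=1]) auto
      have "of_real (?u l \<theta> x) * iexp (x \<bullet> m)
          = 2 * g m x + (iexp \<theta> / 2) * g (l + m) x + (iexp (- \<theta>) / 2) * g (m - l) x" for x
        unfolding g_def inner_add_right inner_diff_right by (rule trig_weight_expand)
      then show ?thesis
        unfolding g_def[symmetric] by simp
    qed
    show ?thesis
      unfolding ex[OF \<open>finite_measure P\<close> sP] ex[OF \<open>finite_measure Q\<close> sQ] eq ..
  qed
  \<comment> \<open>The image of the weighted measure under \<open>x \<bullet> k\<close> has at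
    \<open>t\<close> the transform given by \<open>ueq\<close> at \<open>t *\<^sub>R k\<close>, so
    the two images agree on the line and in particular on \<open>B\<close>.\<close>
  have meas: "(\<integral>x. ?u l \<theta> x * indicator B (x \<bullet> k) \<partial>P) = (\<integral>x. ?u l \<theta> x * indicator B (x \<bullet> k) \<partial>Q)" for l \<theta>
  proof -
    let ?D = "\<lambda>R. distr (density R (\<lambda>x. ennreal (?u l \<theta> x))) borel (\<lambda>x. x \<bullet> k)"
    have fin: "finite_measure (?D R)"
      and ch: "(CLINT y|?D R. iexp (t * y)) = (CLINT x|R. of_real (?u l \<theta> x) * iexp (x \<bullet> (t *\<^sub>R k)))"
      and mB: "measure (?D R) B = (\<integral>x. ?u l \<theta> x * indicator B (x \<bullet> k) \<partial>R)"
      if "finite_measure R" and R [measurable_cong]: "sets R = sets borel" for R :: "'a measure" and t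
    proof -
      interpret R: finite_measure R by fact
      have int: "integrable R (?u l \<theta>)"
        using u0 u3 by (intro R.integrable_const_bound[of _ 3]) (auto simp del: of_real_mult)
      have "(\<integral>\<^sup>+x. ennreal (?u l \<theta> x) \<partial>R) \<noteq> \<infinity>"
        using int u0 by (subst nn_integral_eq_integral) auto
      then have "finite_measure (density R (\<lambda>x. ennreal (?u l \<theta> x)))"
        by (intro finite_measureI) (simp add: emeasure_density cong: nn_integral_cong)
      then show "finite_measure (?D R)"
        by (intro finite_measure.finite_measure_distr) measurable
      show "(CLINT y|?D R. iexp (t * y)) = (CLINT x|R. of_real (?u l \<theta> x) * iexp (x \<bullet> (t *\<^sub>R k)))"
        using u0 by (simp add: integral_distr integral_density scaleR_conv_of_real mult.commute)
      have "measure (?D R) B = (\<integral>y. indicator B y \<partial>?D R)"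
        by simp
      also have "\<dots> = (\<integral>x. ?u l \<theta> x * indicator B (x \<bullet> k) \<partial>R)"
        using u0 by (subst integral_distr) (auto simp: integral_density)
      finally show "measure (?D R) B = (\<integral>x. ?u l \<theta> x * indicator B (x \<bullet> k) \<partial>R)" .
    qed
    have "?D P = ?D Q"
      by (rule finite_measure_eqI_char)
         (simp_all add: fin[OF \<open>finite_measure P\<close> sP] fin[OF \<open>finite_measure Q\<close> sQ]
           ch[OF \<open>finite_measure P\<close> sP] ch[OF \<open>finite_measure Q\<close> sQ] ueq del: of_real_mult inner_scaleR_right)
    then show ?thesis
      using mB[OF \<open>finite_measure P\<close> sP] mB[OF \<open>finite_measure Q\<close> sQ] by simp
  qed
  let ?v = "\<lambda>x. w x * indicator B (x \<bullet> k)"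
  have v: "0 \<le> ?v x" "?v x \<le> 1" for x
    using w0 w1 by (auto simp: indicator_def)
  have ex: "(\<integral>x. ?u l \<theta> x * indicator B (x \<bullet> k) \<partial>R) = 2 * (\<integral>x. ?v x \<partial>R) + (\<integral>x. ?v x * cos (x \<bullet> l + \<theta>) \<partial>R)"
    and cx: "(CLINT x|R. of_real (?v x) * iexp (x \<bullet> l)) = 
       Complex (\<integral>x. ?v x * cos (x \<bullet> l + 0) \<partial>R) (\<integral>x. ?v x * cos (x \<bullet> l + (- pi/2)) \<partial>R)"
    if "finite_measure R" and R [measurable_cong]: "sets R = sets borel" for R :: "'a measure" and l \<theta>
  proof -
    interpret R: finite_measure R by fact
    have 1: "integrable R ?v"
      using v by (intro R.integrable_const_bound[of _ 1]) auto
    have 2: "integrable R (\<lambda>x. ?v x * cos (x \<bullet> l + \<theta>))" for \<theta>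
    proof (rule R.integrable_const_bound[of _ 1])
      have "\<bar>?v x\<bar> * \<bar>cos (x \<bullet> l + \<theta>)\<bar> \<le> 1" for x
        using v[of x] by (intro mult_le_one) auto
      then show "AE x in R. norm (?v x * cos (x \<bullet> l + \<theta>)) \<le> 1"
        by (simp only: real_norm_def abs_mult) simp
    qed measurable
    show "(\<integral>x. ?u l \<theta> x * indicator B (x \<bullet> k) \<partial>R) = 2 * (\<integral>x. ?v x \<partial>R) + (\<integral>x. ?v x * cos (x \<bullet> l + \<theta>) \<partial>R)"
    proof -
      have "?u l \<theta> x * indicator B (x \<bullet> k) = 2 * ?v x + ?v x * cos (x \<bullet> l + \<theta>)" for x
        by (simp add: algebra_simps)
      then show ?thesis
        using Bochner_Integration.integral_add[OF integrable_mult_right[OF 1, of 2] 2[of \<theta>]]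
        by (simp only: integral_mult_right_zero)
    qed
    have 3: "integrable R (\<lambda>x. of_real (?v x) * iexp (x \<bullet> l))"
      using v by (intro R.integrable_iexp_weight[where C=1]) auto
    have s: "cos (x \<bullet> l + (- pi/2)) = sin (x \<bullet> l)" for x
      by (simp add: cos_diff)
    show "(CLINT x|R. of_real (?v x) * iexp (x \<bullet> l)) = 
       Complex (\<integral>x. ?v x * cos (x \<bullet> l + 0) \<partial>R) (\<integral>x. ?v x * cos (x \<bullet> l + (- pi/2)) \<partial>R)"
    proof (rule complex_eqI)
      have "Re (of_real (?v x) * iexp (x \<bullet> l)) = ?v x * cos (x \<bullet> l + 0)"
        and "Im (of_real (?v x) * iexp (x \<bullet> l)) = ?v x * cos (x \<bullet> l + (- pi/2))" for x
        unfolding s by (simp_all add: Re_exp Im_exp)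
      then show "Re (CLINT x|R. of_real (?v x) * iexp (x \<bullet> l)) = Re (Complex (\<integral>x. ?v x * cos (x \<bullet> l + 0) \<partial>R) (\<integral>x. ?v x * cos (x \<bullet> l + (- pi/2)) \<partial>R))"
        and "Im (CLINT x|R. of_real (?v x) * iexp (x \<bullet> l)) = Im (Complex (\<integral>x. ?v x * cos (x \<bullet> l + 0) \<partial>R) (\<integral>x. ?v x * cos (x \<bullet> l + (- pi/2)) \<partial>R))"
        by (simp_all only: integral_Re[OF 3, symmetric] integral_Im[OF 3, symmetric] complex.sel)
    qed
  qed
  \<comment> \<open>At \<open>l = 0\<close>, \<open>\<theta> = 0\<close> the modulation is the
    constant 3, which isolates the integral of \<open>?v\<close>; twice this integral can then be
    removed from \<open>meas\<close> for general \<open>l\<close> and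
    \<open>\<theta>\<close>.\<close>
  have v_eq: "(\<integral>x. ?v x \<partial>P) = (\<integral>x. ?v x \<partial>Q)"
    using meas[of 0 0] unfolding ex[OF \<open>finite_measure P\<close> sP] ex[OF \<open>finite_measure Q\<close> sQ] by simp
  have "(\<integral>x. ?v x * cos (x \<bullet> l + \<theta>) \<partial>P) = (\<integral>x. ?v x * cos (x \<bullet> l + \<theta>) \<partial>Q)" for l \<theta>
    using meas[of l \<theta>] v_eq unfolding ex[OF \<open>finite_measure P\<close> sP] ex[OF \<open>finite_measure Q\<close> sQ] by simp
  then show ?thesis
    by (simp only: cx[OF \<open>finite_measure P\<close> sP] cx[OF \<open>finite_measure Q\<close> sQ])
qed

text \<open>Half-spaces generate the Borel sets but are not stable under intersection, so
  finite-dimensional cylinders are used. Induction restricts both functionals to one coordinate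
  after another, and frequency 0 then gives equal measure to every cylinder.\<close>

lemma finite_measure_eqI_charfun:
  fixes P Q :: "'a::{real_inner,second_countable_topology} measure"
  assumes fP: "finite_measure P" and fQ: "finite_measure Q"
    and sP [measurable_cong]: "sets P = sets borel" and sQ [measurable_cong]: "sets Q = sets borel"
    and eq: "\<And>l. (CLINT x|P. iexp (x \<bullet> l)) = (CLINT x|Q. iexp (x \<bullet> l))"
  shows "P = Q"
proof -
  interpret P: finite_measure P by fact
  interpret Q: finite_measure Q by fact
  let ?A = "\<lambda>F B. {x::'a. \<forall>k\<in>F. x \<bullet> k \<in> B k}"
  define E where "E = {?A F B | F B. finite F \<and> (\<forall>k. B k \<in> sets (borel :: real measure))}"
  have A_meas [measurable]: "?A F B \<in> sets borel" if "finite F" "\<And>k. B k \<in> sets borel" for F B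
  proof -
    have *: "{x. x \<bullet> k \<in> B k} \<in> sets borel" for k
      using measurable_sets[OF borel_measurable_inner_right that(2)[of k]] by (simp add: vimage_def)
    have "?A F B = (\<Inter>k\<in>F. {x. x \<bullet> k \<in> B k})" by auto
    also have "\<dots> \<in> sets borel"
      using that * by (cases "F = {}") (auto intro!: sets.finite_INT)
    finally show ?thesis .
  qed
  have cyl: "\<forall>l. (CLINT x|P. of_real (indicator (?A F B) x) * iexp (x \<bullet> l))
      = (CLINT x|Q. of_real (indicator (?A F B) x) * iexp (x \<bullet> l))"
    if "finite F" and B: "\<And>k. B k \<in> sets borel" for F B
    using that(1)
  proof (induction F)
    case empty
    then show ?case using eq by simp
  next
    case (insert j F)
    have *: "indicator (?A (insert j F) B) x = indicator (?A F B) x * (indicator (B j) (x \<bullet> j) :: real)" for x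
      by (auto simp: indicator_def)
    show ?case
      unfolding * using insert(3)
      by (intro allI charfun_eq_restrict_cylinder fP fQ sP sQ borel_measurable_indicator A_meas insert(1) B) auto
  qed
  have me: "measure P X = measure Q X" if "X \<in> E" for X
  proof -
    obtain F B where X: "X = ?A F B" and FB: "finite F" "\<And>k. B k \<in> sets borel"
      using \<open>X \<in> E\<close> by (auto simp: E_def)
    have [measurable]: "X \<in> sets borel" unfolding X using FB by (rule A_meas)
    have "(CLINT x|R. of_real (indicator X x) * iexp (x \<bullet> 0)) = of_real (measure R X)"
      if "sets R = sets borel" for R :: "'a measure"
      using that sets_eq_imp_space_eq[OF that] by (simp add: integral_complex_of_real)
    from this[OF sP] this[OF sQ] cyl[OF FB, THEN spec[where x=0]] show ?thesis
      by (simp add: X)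
  qed
  have borel_E: "sets borel = sigma_sets (UNIV :: 'a set) E"
  proof
    show "sigma_sets UNIV E \<subseteq> sets (borel :: 'a measure)"
    proof -
      have "E \<subseteq> sets borel"
        using A_meas by (auto simp: E_def)
      then show ?thesis
        using sets.sigma_sets_subset[of E borel] by simp
    qed
    have "{x. x \<bullet> k \<le> r} \<in> E" for k :: 'a and r
      unfolding E_def by (intro CollectI exI[of _ "{k}"] exI[of _ "\<lambda>_. {..r}"]) auto
    then show "sets borel \<subseteq> sigma_sets (UNIV :: 'a set) E"
      unfolding borel_halfspaces by (intro sigma_sets_mono') auto
  qed
  have UNIV_E: "UNIV \<in> E"
    unfolding E_def by (intro CollectI exI[of _ "{}"] exI[of _ "\<lambda>_. UNIV"]) auto
  show "P = Q"
  proof (rule measure_eqI_generator_eq[where \<Omega>=UNIV and E=E and A="\<lambda>_. UNIV"])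
    show "Int_stable E"
    proof (rule Int_stableI)
      fix X Y assume "X \<in> E" "Y \<in> E"
      then obtain F B F' B' where X: "X = ?A F B" "finite F" "\<And>k. B k \<in> sets borel"
        and Y: "Y = ?A F' B'" "finite F'" "\<And>k. B' k \<in> sets borel"
        unfolding E_def by blast
      \<comment> \<open>A coordinate missing from \<open>F\<close> or \<open>F'\<close> is
        unconstrained there, so both cylinders can be read over
        \<open>F \<union> F'\<close>.\<close>
      define C where "C k = (if k \<in> F then B k else UNIV) \<inter> (if k \<in> F' then B' k else UNIV)" for k
      have "X \<inter> Y = ?A (F \<union> F') C"
        unfolding X(1) Y(1) C_def by auto
      moreover have "C k \<in> sets borel" for k
        unfolding C_def using X(3)[of k] Y(3)[of k] by simp
      ultimately show "X \<inter> Y \<in> E"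
        unfolding E_def using X(2) Y(2)
        by (intro CollectI exI[of _ "F \<union> F'"] exI[of _ C] conjI) (simp_all del: Int_iff)
    qed
    show "emeasure P X = emeasure Q X" if "X \<in> E" for X
      using me[OF that] by (simp add: P.emeasure_eq_measure Q.emeasure_eq_measure)
    show "sets P = sigma_sets UNIV E" "sets Q = sigma_sets UNIV E"
      by (simp_all only: sP sQ borel_E)
    show "range (\<lambda>_. UNIV) \<subseteq> E"
      using UNIV_E by simp
  qed simp_all
qed

subsection \<open>Centered Gaussian measures\<close>

lemma char_centered_normal:
  assumes "s > 0"
  shows "char (density lborel (normal_density 0 s)) t = exp (- (s\<^sup>2 * t\<^sup>2) / 2)"
proof -
  interpret prob_space std_normal_distribution
    by (rule prob_space_normal_density) simp
  have "distributed std_normal_distribution lborel (\<lambda>x. 0 + s * x) (normal_density (0 + s * 0) (\<bar>s\<bar> * 1))"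
    using assms by (intro normal_density_affine) (auto simp: distributed_def distr_id2)
  then have "density lborel (normal_density 0 s) = distr std_normal_distribution borel (\<lambda>x. s * x)"
    using assms by (simp add: distributed_def cong: distr_cong)
  then have "char (density lborel (normal_density 0 s)) t = char std_normal_distribution (s * t)"
    by (simp add: char_def integral_distr mult_ac)
  then show ?thesis
    by (simp add: char_std_normal_distribution power_mult_distrib)
qed

text \<open>The point mass at 0 obeys the same formula with second moment 0, so degenerate
  directions need no separate treatment afterwards.\<close>

lemma centered_gaussian_real_facts:
  assumes "centered_gaussian_real L"
  shows "integrable L (\<lambda>x. x\<^sup>2)"
    and "char L t = exp (- ((\<integral>x. x\<^sup>2 \<partial>L) * t\<^sup>2) / 2)"
proof -
  have "integrable L (\<lambda>x. x\<^sup>2) \<and> char L t = exp (- ((\<integral>x. x\<^sup>2 \<partial>L) * t\<^sup>2) / 2)"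
    using assms unfolding centered_gaussian_real_def
  proof
    assume L: "L = return borel 0"
    have "integrable L (\<lambda>x. x\<^sup>2)"
      unfolding L by (rule integrableI_bounded) (auto simp: nn_integral_return)
    then show ?thesis
      by (auto simp: L char_def integral_return)
  next
    assume "\<exists>s>0. L = density lborel (normal_density 0 s)"
    then obtain s where s: "s > 0" and L: "L = density lborel (normal_density 0 s)" by blast
    have "integrable L (\<lambda>x. x\<^sup>2)"
      using integrable_normal_moment[OF s, of 0 2] unfolding L by (simp add: integrable_density)
    moreover have "(\<integral>x. x\<^sup>2 \<partial>L) = s\<^sup>2"
      using integral_normal_moment_even[OF s, of 0 1] unfolding L
      by (simp add: integral_density fact_numeral power2_eq_square)
    ultimately show ?thesis
      using char_centered_normal[OF s] by (simp add: L)
  qed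
  then show "integrable L (\<lambda>x. x\<^sup>2)" "char L t = exp (- ((\<integral>x. x\<^sup>2 \<partial>L) * t\<^sup>2) / 2)"
    by auto
qed

locale centered_gaussian =
  fixes N :: "'a::{real_inner,polish_space} measure"
  assumes gaussian: "centered_gaussian_measure N"
begin

sublocale prob_space N
  using gaussian by (simp add: centered_gaussian_measure_def)

lemma sets_N [measurable_cong]: "sets N = sets borel"
  using gaussian by (simp add: centered_gaussian_measure_def)

text \<open>The covariance operator C in the guise of its bilinear form, the L2(\<open>N\<close>)
  inner product of two linear functionals.\<close>

definition cov :: "'a \<Rightarrow> 'a \<Rightarrow> real" where
  "cov k l = (\<integral>x. (x \<bullet> k) * (x \<bullet> l) \<partial>N)"

lemma integrable_inner_square: "integrable N (\<lambda>x. (x \<bullet> k)\<^sup>2)"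
proof -
  have "integrable (distr N borel (\<lambda>x. x \<bullet> k)) (\<lambda>x. x\<^sup>2)"
    using gaussian by (intro centered_gaussian_real_facts(1)) (simp add: centered_gaussian_measure_def)
  then show ?thesis
    by (subst (asm) integrable_distr_eq) auto
qed

lemma charfun: "(CLINT x|N. iexp (x \<bullet> k)) = exp (- cov k k / 2)"
proof -
  have "char (distr N borel (\<lambda>x. x \<bullet> k)) 1
      = exp (- ((\<integral>x. x\<^sup>2 \<partial>distr N borel (\<lambda>x. x \<bullet> k)) * 1\<^sup>2) / 2)"
    using gaussian by (intro centered_gaussian_real_facts(2)) (simp add: centered_gaussian_measure_def)
  then show ?thesis
    by (simp add: char_def cov_def integral_distr power2_eq_square)
qed

lemma integrable_inner_mult [simp]: "integrable N (\<lambda>x. (x \<bullet> k) * (x \<bullet> l))"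
proof (rule Bochner_Integration.integrable_bound)
  show "integrable N (\<lambda>x. (x \<bullet> k)\<^sup>2 + (x \<bullet> l)\<^sup>2)"
    by (intro Bochner_Integration.integrable_add integrable_inner_square)
  show "AE x in N. norm ((x \<bullet> k) * (x \<bullet> l)) \<le> norm ((x \<bullet> k)\<^sup>2 + (x \<bullet> l)\<^sup>2)"
  proof (rule AE_I2)
    fix x
    have "\<bar>a * b\<bar> \<le> a\<^sup>2 + b\<^sup>2" for a b :: real
    proof -
      have "0 \<le> \<bar>a\<bar> * \<bar>b\<bar>" by simp
      moreover have "2 * (\<bar>a\<bar> * \<bar>b\<bar>) \<le> a\<^sup>2 + b\<^sup>2"
        using sum_squares_bound[of "\<bar>a\<bar>" "\<bar>b\<bar>"] by (simp add: mult.assoc)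
      ultimately show ?thesis
        unfolding abs_mult by linarith
    qed
    then show "norm ((x \<bullet> k) * (x \<bullet> l)) \<le> norm ((x \<bullet> k)\<^sup>2 + (x \<bullet> l)\<^sup>2)" by simp
  qed
qed measurable

lemma integrable_abs_inner [simp]: "integrable N (\<lambda>x. \<bar>x \<bullet> k\<bar>)"
  using square_integrable_imp_integrable[OF _ integrable_inner_square[of k]] by auto

lemma cov_commute: "cov k l = cov l k"
  by (simp add: cov_def mult.commute)

lemma cov_add_left: "cov (k + l) m = cov k m + cov l m"
  by (simp add: cov_def inner_add_right algebra_simps)

lemma cov_scaleR_left: "cov (r *\<^sub>R k) l = r * cov k l"
  by (simp add: cov_def mult.assoc)

lemma cov_add_right: "cov m (k + l) = cov m k + cov m l"
  by (metis cov_add_left cov_commute)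

lemma cov_scaleR_right: "cov l (r *\<^sub>R k) = r * cov l k"
  by (metis cov_scaleR_left cov_commute)

lemma cov_diff_left: "cov (k - l) m = cov k m - cov l m"
  using cov_add_left[of k "- l" m] cov_scaleR_left[of "-1" l m] by simp

lemma cov_diff_right: "cov m (k - l) = cov m k - cov m l"
  by (metis cov_diff_left cov_commute)

lemmas cov_simps = cov_add_left cov_add_right cov_diff_left cov_diff_right
  cov_scaleR_left cov_scaleR_right

lemma cov_nonneg: "0 \<le> cov k k"
  by (simp add: cov_def)

lemma cov_eq_square: "(\<integral>x. (x \<bullet> k)\<^sup>2 \<partial>N) = cov k k"
  by (simp add: cov_def power2_eq_square)

text \<open>Nonnegativity of the variance of \<open>\<bar>x \<bullet> k\<bar>\<close>. It turns
  covariance bounds into L1 bounds, which can be summed.\<close>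

lemma expectation_abs_inner_le: "(\<integral>x. \<bar>x \<bullet> k\<bar> \<partial>N) \<le> sqrt (cov k k)"
proof -
  have "0 \<le> (\<integral>x. (\<bar>x \<bullet> k\<bar> - (\<integral>x. \<bar>x \<bullet> k\<bar> \<partial>N))\<^sup>2 \<partial>N)"
    by simp
  also have "\<dots> = cov k k - (\<integral>x. \<bar>x \<bullet> k\<bar> \<partial>N)\<^sup>2"
    by (subst variance_eq) (auto simp: cov_eq_square integrable_inner_square)
  finally show ?thesis
    by (intro real_le_rsqrt) simp
qed

end

text \<open>By monotone convergence the sum of the series has a finite integral, hence is finite
  almost everywhere.\<close>

lemma AE_summable_of_summable_integral:
  fixes f :: "nat \<Rightarrow> 'b \<Rightarrow> real"
  assumes int: "\<And>n. integrable M (f n)" and nn: "\<And>n x. 0 \<le> f n x"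
    and sum: "summable (\<lambda>n. \<integral>x. f n x \<partial>M)"
  shows "AE x in M. summable (\<lambda>n. f n x)"
proof -
  have [measurable]: "f n \<in> borel_measurable M" for n using int by auto
  have "(\<integral>\<^sup>+x. (\<Sum>n. ennreal (f n x)) \<partial>M) = (\<Sum>n. ennreal (\<integral>x. f n x \<partial>M))"
    using nn by (subst nn_integral_suminf) (auto simp: nn_integral_eq_integral int)
  also have "\<dots> < \<infinity>"
    using sum nn by (simp add: suminf_ennreal_eq[OF _ summable_sums] )
  finally have "AE x in M. (\<Sum>n. ennreal (f n x)) \<noteq> \<infinity>"
    by (intro nn_integral_noteq_infinite) auto
  then show ?thesis
    by eventually_elim (use nn in \<open>auto intro: summable_suminf_not_top\<close>)
qed

context centered_gaussian
begin

subsection \<open>Splitting off a Cameron--Martin direction\<close>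

text \<open>Homogeneity: rescale \<open>k\<close> and \<open>- k\<close> into the unit ball of
  \<open>cov\<close> and apply \<open>d\<close>. The form may vanish at \<open>k\<close>, so the
  rescaling uses a slightly larger positive number.\<close>

lemma inner_square_le_cov:
  assumes d: "\<And>k. cov k k \<le> 1 \<Longrightarrow> d \<bullet> k \<le> s"
  shows "(d \<bullet> k)\<^sup>2 \<le> s\<^sup>2 * cov k k"
proof (rule field_le_epsilon)
  fix e :: real assume e: "e > 0"
  \<comment> \<open>Multiplied by \<open>s\<^sup>2\<close>, the added term
    \<open>e / (s\<^sup>2 + 1)\<close> stays at most \<open>e\<close>, also when
    \<open>s = 0\<close>.\<close>
  define q where "q = cov k k + e / (s\<^sup>2 + 1)"
  have s1: "s\<^sup>2 + 1 > 0" by (simp add: add_nonneg_pos)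
  have q: "q > 0"
    unfolding q_def using e cov_nonneg[of k] s1 by (intro add_nonneg_pos) auto
  have s0: "0 \<le> s"
    using d[of 0] by (simp add: cov_def)
  have le: "cov k k \<le> q"
    unfolding q_def using e s1 by simp
  have "d \<bullet> l \<le> s * sqrt q" if "cov l l = cov k k" for l
  proof -
    have "cov ((1 / sqrt q) *\<^sub>R l) ((1 / sqrt q) *\<^sub>R l) \<le> 1"
      using q le that by (simp add: cov_simps field_simps power2_eq_square[symmetric])
    from d[OF this] show ?thesis
      using q by (simp add: field_simps)
  qed
  from this[of k] this[of "- k"] have "\<bar>d \<bullet> k\<bar> \<le> s * sqrt q"
    using cov_scaleR_left[of "-1" k "- k"] cov_scaleR_right[of k "-1" k] by (simp add: abs_le_iff)
  then have "(d \<bullet> k)\<^sup>2 \<le> (s * sqrt q)\<^sup>2"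
    using s0 q by (intro abs_le_square_iff[THEN iffD1]) simp
  also have "\<dots> = s\<^sup>2 * cov k k + (s\<^sup>2 / (s\<^sup>2 + 1)) * e"
    using q by (simp add: power_mult_distrib q_def algebra_simps)
  also have "\<dots> \<le> s\<^sup>2 * cov k k + 1 * e"
    using s1 e by (intro add_left_mono mult_right_mono) auto
  finally show "(d \<bullet> k)\<^sup>2 \<le> s\<^sup>2 * cov k k + e" by simp
qed

text \<open>The increments have L1 norm at most \<open>(1/2)^n\<close>, so they are absolutely
  summable almost surely, and their partial sums telescope.\<close>

lemma AE_convergent_inner:
  assumes "\<And>n. cov (k (Suc n) - k n) (k (Suc n) - k n) \<le> (1/4)^n"
  shows "AE x in N. convergent (\<lambda>n. x \<bullet> k n)"
proof -
  have le: "(\<integral>x. \<bar>x \<bullet> (k (Suc n) - k n)\<bar> \<partial>N) \<le> (1/2)^n" for n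
  proof -
    have "(\<integral>x. \<bar>x \<bullet> (k (Suc n) - k n)\<bar> \<partial>N) \<le> sqrt ((1/4)^n)"
      using expectation_abs_inner_le[of "k (Suc n) - k n"] real_sqrt_le_mono[OF assms[of n]] by linarith
    also have "sqrt ((1/4)^n) = (1/2)^n"
      by (intro real_sqrt_unique) (simp_all add: power_mult_distrib[symmetric] power2_eq_square)
    finally show ?thesis .
  qed
  have "summable (\<lambda>n. \<integral>x. \<bar>x \<bullet> (k (Suc n) - k n)\<bar> \<partial>N)"
    by (rule summable_comparison_test'[of "\<lambda>n. (1/2)^n" 0]) (use le in auto)
  then have "AE x in N. summable (\<lambda>n. \<bar>x \<bullet> (k (Suc n) - k n)\<bar>)"
    by (intro AE_summable_of_summable_integral) auto
  then show ?thesis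
  proof eventually_elim
    case (elim x)
    then have "summable (\<lambda>n. x \<bullet> k (Suc n) - x \<bullet> k n)"
      by (auto intro: summable_rabs_cancel simp: inner_diff_right)
    then have "convergent (\<lambda>n. \<Sum>i<n. x \<bullet> k (Suc i) - x \<bullet> k i)"
      by (simp add: summable_iff_convergent)
    moreover have "(\<Sum>i<n. x \<bullet> k (Suc i) - x \<bullet> k i) = x \<bullet> k n - x \<bullet> k 0" for n
      by (rule sum_lessThan_telescope)
    ultimately have "convergent (\<lambda>n. x \<bullet> k n - x \<bullet> k 0)"
      by (simp only:)
    then have "convergent (\<lambda>n. (x \<bullet> k n - x \<bullet> k 0) + x \<bullet> k 0)"
      by (intro convergent_add convergent_const)
    then show ?case by simp
  qed
qed

text \<open>The limit of \<open>x \<bullet> k n\<close> is the measurable linear functional representing \<open>d / s\<close> in the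
  Cameron--Martin isometry.\<close>

lemma cm_maximizing_sequence:
  assumes bdd: "\<And>k. cov k k \<le> 1 \<Longrightarrow> d \<bullet> k \<le> \<mu>" and "d \<noteq> 0"
  obtains s k where "0 < s" "s \<le> \<mu>"
    and "AE x in N. convergent (\<lambda>n. x \<bullet> k n)"
    and "\<And>l. (\<lambda>n. cov l (k n)) \<longlonglongrightarrow> (d \<bullet> l) / s"
    and "(\<lambda>n. cov (k n) (k n)) \<longlonglongrightarrow> 1"
proof -
  let ?K = "{k. cov k k \<le> 1}"
  define s where "s = (SUP k\<in>?K. d \<bullet> k)"
  have bdd': "bdd_above ((\<bullet>) d ` ?K)"
    using bdd by (intro bdd_aboveI[of _ \<mu>]) auto
  have ne: "0 \<in> ?K"
    by (simp add: cov_def)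
  have ds: "d \<bullet> k \<le> s" if "cov k k \<le> 1" for k
    unfolding s_def using that by (intro cSUP_upper[OF _ bdd']) auto
  have "s \<le> \<mu>"
    unfolding s_def using ne bdd by (intro cSUP_least) auto
  have "s > 0"
  proof -
    \<comment> \<open>A multiple of \<open>d\<close> itself serves as test direction; this factor
      puts it into the unit ball of \<open>cov\<close> even if \<open>cov d d = 0\<close>.\<close>
    define r where "r = 1 / (1 + cov d d)"
    have c: "cov d d \<ge> 0" by (rule cov_nonneg)
    then have r: "r > 0" by (simp add: r_def add_pos_nonneg)
    have "cov (r *\<^sub>R d) (r *\<^sub>R d) = cov d d / (1 + cov d d) / (1 + cov d d)"
      by (simp add: cov_simps r_def)
    also have "\<dots> \<le> 1"
      using c by (simp add: divide_simps) (simp add: algebra_simps)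
    finally have "d \<bullet> (r *\<^sub>R d) \<le> s" by (rule ds)
    moreover have "d \<bullet> (r *\<^sub>R d) > 0"
      using r \<open>d \<noteq> 0\<close> by simp
    ultimately show ?thesis by linarith
  qed
  \<comment> \<open>The parallelogram estimate below bounds the increments by
    \<open>8 * \<eta> n\<close>, which is the rate \<open>(1/4)^n\<close> that
    \<open>AE_convergent_inner\<close> asks for.\<close>
  define \<eta> where "\<eta> n = (1/4)^n / (8::real)" for n :: nat
  have \<eta>: "0 < \<eta> n" "\<eta> n \<le> 1/8" "\<eta> (Suc n) \<le> \<eta> n" for n
    unfolding \<eta>_def by (auto simp: power_le_one)
  have "\<exists>k. cov k k \<le> 1 \<and> s * (1 - \<eta> n) < d \<bullet> k" for n
  proof -
    have "s * (1 - \<eta> n) < s"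
      using \<open>s > 0\<close> \<eta>(1)[of n] by (simp add: algebra_simps)
    then have "s * (1 - \<eta> n) < (SUP k\<in>?K. d \<bullet> k)"
      by (simp only: s_def)
    then show ?thesis
      using ne by (subst (asm) less_cSUP_iff[OF _ bdd']) auto
  qed
  then obtain k where k1: "\<And>n. cov (k n) (k n) \<le> 1" and k2: "\<And>n. s * (1 - \<eta> n) < d \<bullet> k n"
    by metis
  have sq: "(d \<bullet> l)\<^sup>2 \<le> s\<^sup>2 * cov l l" for l
    by (rule inner_square_le_cov) (rule ds)
  \<comment> \<open>Near-maximizers are close: \<open>d\<close> is nearly \<open>2 * s\<close> on
    the sum of two of them, so by \<open>sq\<close> the sum has \<open>cov\<close> near 4, and the
    parallelogram law leaves little for the difference.\<close>
  have "cov (k (Suc n) - k n) (k (Suc n) - k n) \<le> (1/4)^n" for n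
  proof -
    let ?c = "cov (k (Suc n) + k n) (k (Suc n) + k n)"
    have "s * (1 - \<eta> (Suc n)) \<ge> s * (1 - \<eta> n)"
      using \<open>s > 0\<close> \<eta>(3)[of n] by simp
    then have "s * (2 - 2 * \<eta> n) \<le> d \<bullet> (k (Suc n) + k n)"
      using k2[of n] k2[of "Suc n"] by (simp add: inner_add_right algebra_simps)
    moreover have "0 \<le> s * (2 - 2 * \<eta> n)"
      using \<open>s > 0\<close> \<eta>(2)[of n] by simp
    ultimately have "(s * (2 - 2 * \<eta> n))\<^sup>2 \<le> (d \<bullet> (k (Suc n) + k n))\<^sup>2"
      by (intro power_mono)
    also have "\<dots> \<le> s\<^sup>2 * ?c" by (rule sq)
    finally have "(2 - 2 * \<eta> n)\<^sup>2 \<le> ?c"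
      using \<open>s > 0\<close> by (simp add: power_mult_distrib)
    moreover have "cov (k (Suc n) - k n) (k (Suc n) - k n)
        = 2 * cov (k (Suc n)) (k (Suc n)) + 2 * cov (k n) (k n) - ?c"
      by (simp add: cov_simps)
    moreover have "(2 - 2 * \<eta> n)\<^sup>2 = 4 - 8 * \<eta> n + 4 * (\<eta> n)\<^sup>2"
      by (simp add: power2_eq_square algebra_simps)
    moreover have "0 \<le> (\<eta> n)\<^sup>2" by simp
    moreover have "8 * \<eta> n = (1/4)^n" by (simp add: \<eta>_def)
    ultimately show ?thesis
      using k1[of n] k1[of "Suc n"] by linarith
  qed
  then have conv: "AE x in N. convergent (\<lambda>n. x \<bullet> k n)"
    by (rule AE_convergent_inner)
  have \<eta>0: "\<eta> \<longlonglongrightarrow> 0"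
    unfolding \<eta>_def by real_asymp
  have dk: "(\<lambda>n. d \<bullet> k n) \<longlonglongrightarrow> s"
  proof (rule tendsto_sandwich)
    have "(\<lambda>n. s * (1 - \<eta> n)) \<longlonglongrightarrow> s * (1 - 0)"
      by (intro tendsto_intros \<eta>0)
    then show "(\<lambda>n. s * (1 - \<eta> n)) \<longlonglongrightarrow> s" by simp
    show "\<forall>\<^sub>F n in sequentially. s * (1 - \<eta> n) \<le> d \<bullet> k n"
      using k2 by (intro always_eventually) (simp add: less_imp_le)
    show "\<forall>\<^sub>F n in sequentially. d \<bullet> k n \<le> s"
      using ds k1 by (intro always_eventually) simp
  qed simp
  have ckk: "(\<lambda>n. cov (k n) (k n)) \<longlonglongrightarrow> 1"
  proof (rule tendsto_sandwich)
    have "(\<lambda>n. (d \<bullet> k n)\<^sup>2 / s\<^sup>2) \<longlonglongrightarrow> s\<^sup>2 / s\<^sup>2"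
      by (intro tendsto_intros dk) (use \<open>s > 0\<close> in simp)
    then show "(\<lambda>n. (d \<bullet> k n)\<^sup>2 / s\<^sup>2) \<longlonglongrightarrow> 1"
      using \<open>s > 0\<close> by simp
    show "\<forall>\<^sub>F n in sequentially. (d \<bullet> k n)\<^sup>2 / s\<^sup>2 \<le> cov (k n) (k n)"
      using sq[of "k _"] \<open>s > 0\<close> by (intro always_eventually allI) (simp add: field_simps)
    show "\<forall>\<^sub>F n in sequentially. cov (k n) (k n) \<le> 1"
      using k1 by simp
  qed simp
  have cl: "(\<lambda>n. cov l (k n)) \<longlonglongrightarrow> (d \<bullet> l) / s" for l
  proof -
    \<comment> \<open>\<open>r\<close> is a nonnegative quadratic form and \<open>R n\<close> is its
      polar form at \<open>l\<close> and \<open>k n\<close>. Since \<open>r (k n)\<close> tends to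
      0, Cauchy-Schwarz drives \<open>R\<close> to 0, which is the claimed limit.\<close>
    define r where "r j = s\<^sup>2 * cov j j - (d \<bullet> j)\<^sup>2" for j
    define R where "R n = s\<^sup>2 * cov l (k n) - (d \<bullet> l) * (d \<bullet> k n)" for n
    have r0: "0 \<le> r j" for j
      using sq by (simp add: r_def)
    have R_le: "(R n)\<^sup>2 \<le> r (k n) * (r l + 1)" for n
    proof -
      \<comment> \<open>The minimizer of
        \<open>r (k n) + 2 * t * R n + t\<^sup>2 * (r l + 1)\<close>; the added 1 keeps the
        denominator positive when \<open>r l = 0\<close>.\<close>
      define t where "t = - R n / (r l + 1)"
      have rl: "r l + 1 > 0" using r0[of l] by simp
      have "r (k n + t *\<^sub>R l) = r (k n) + 2 * t * R n + t\<^sup>2 * r l"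
        by (simp add: r_def R_def cov_simps cov_commute[of "k n" l] inner_add_right
            power2_eq_square algebra_simps)
      also have "t\<^sup>2 * r l \<le> t\<^sup>2 * (r l + 1)"
        by (intro mult_left_mono) auto
      also have "t\<^sup>2 * (r l + 1) = - t * R n"
        using rl by (simp add: t_def power2_eq_square)
      finally have "0 \<le> r (k n) + t * R n"
        using r0[of "k n + t *\<^sub>R l"] by simp
      also have "t * R n = - ((R n)\<^sup>2 / (r l + 1))"
        by (simp add: t_def power2_eq_square)
      finally show ?thesis
        using rl by (simp add: divide_le_eq)
    qed
    have "(\<lambda>n. r (k n) * (r l + 1)) \<longlonglongrightarrow> (s\<^sup>2 * 1 - s\<^sup>2) * (r l + 1)"
      unfolding r_def by (intro tendsto_intros ckk dk)
    then have lim: "(\<lambda>n. r (k n) * (r l + 1)) \<longlonglongrightarrow> 0"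
      by simp
    have "(\<lambda>n. (R n)\<^sup>2) \<longlonglongrightarrow> 0"
      by (rule tendsto_sandwich[OF always_eventually always_eventually tendsto_const lim])
         (simp_all add: R_le del: mult_minus_left)
    then have R0: "R \<longlonglongrightarrow> 0"
      using tendsto_real_sqrt[of "\<lambda>n. (R n)\<^sup>2" 0 sequentially] by (simp add: tendsto_rabs_zero_iff)
    have "(\<lambda>n. (R n + (d \<bullet> l) * (d \<bullet> k n)) / s\<^sup>2) \<longlonglongrightarrow> (0 + (d \<bullet> l) * s) / s\<^sup>2"
      by (intro tendsto_intros R0 dk) (use \<open>s > 0\<close> in simp)
    then show ?thesis
      using \<open>s > 0\<close> by (simp add: R_def power2_eq_square)
  qed
  show ?thesis
    using that[OF \<open>s > 0\<close> \<open>s \<le> \<mu>\<close> conv cl ckk] .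
qed

text \<open>The complement is the law of \<open>x - c * \<xi> x *\<^sub>R d\<close>, where \<open>\<xi>\<close> has unit variance and
  \<open>c = 1/s - sqrt (1/s\<^sup>2 - 1/\<mu>\<^sup>2)\<close> is a root of \<open>c\<^sup>2 - 2 * c / s + 1 / \<mu>\<^sup>2 = 0\<close>; its covariance
  form is \<open>cov k k - (d \<bullet> k)\<^sup>2 / \<mu>\<^sup>2\<close>.\<close>

lemma ex_complement_measure:
  assumes \<mu>: "\<mu> > 0" and bdd: "\<And>k. cov k k \<le> 1 \<Longrightarrow> d \<bullet> k \<le> \<mu>"
  shows "\<exists>W. prob_space W \<and> sets W = sets borel \<and>
    (\<forall>k. (CLINT w|W. iexp (w \<bullet> k)) = exp (- (cov k k - (d \<bullet> k)\<^sup>2 / \<mu>\<^sup>2) / 2))"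
proof (cases "d = 0")
  case True
  then show ?thesis
    using prob_space_axioms sets_N charfun by (intro exI[of _ N]) simp
next
  case False
  obtain s k where s: "0 < s" "s \<le> \<mu>"
    and conv: "AE x in N. convergent (\<lambda>n. x \<bullet> k n)"
    and cl: "\<And>l. (\<lambda>n. cov l (k n)) \<longlonglongrightarrow> (d \<bullet> l) / s"
    and ckk: "(\<lambda>n. cov (k n) (k n)) \<longlonglongrightarrow> 1"
    using cm_maximizing_sequence[OF bdd False] by blast
  define c where "c = 1 / s - sqrt (1 / s\<^sup>2 - 1 / \<mu>\<^sup>2)"
  have "1 / s\<^sup>2 \<ge> 1 / \<mu>\<^sup>2"
    using s by (intro divide_left_mono power_mono) auto
  have c: "c\<^sup>2 - 2 * c / s = - (1 / \<mu>\<^sup>2)"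
  proof -
    define q where "q = sqrt (1 / s\<^sup>2 - 1 / \<mu>\<^sup>2)"
    have "q\<^sup>2 = 1 / s\<^sup>2 - 1 / \<mu>\<^sup>2"
      using \<open>1 / s\<^sup>2 \<ge> 1 / \<mu>\<^sup>2\<close> by (simp add: q_def)
    moreover have "c\<^sup>2 - 2 * c / s = q\<^sup>2 - 1 / s\<^sup>2"
    proof -
      have "(u - q)\<^sup>2 - 2 * (u - q) * u = q\<^sup>2 - u\<^sup>2" for u
        by (simp add: power2_eq_square algebra_simps)
      from this[of "1 / s"] show ?thesis
        unfolding c_def q_def[symmetric] by (simp add: power_divide)
    qed
    ultimately show ?thesis by simp
  qed
  \<comment> \<open>Where the sequence diverges, \<open>lim\<close> is an unspecified value; that
    set is null, and measurability of \<open>lim\<close> holds regardless.\<close>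
  define \<xi> where "\<xi> x = lim (\<lambda>n. x \<bullet> k n)" for x
  define T where "T x = x - (c * \<xi> x) *\<^sub>R d" for x
  have [measurable]: "\<xi> \<in> borel_measurable borel"
    unfolding \<xi>_def by (intro borel_measurable_lim_metric) measurable
  have T [measurable]: "T \<in> borel_measurable borel"
    unfolding T_def by measurable
  have "(CLINT w|distr N borel T. iexp (w \<bullet> l)) = exp (- (cov l l - (d \<bullet> l)\<^sup>2 / \<mu>\<^sup>2) / 2)" for l
  proof -
    \<comment> \<open>\<open>T x \<bullet> l\<close> is the almost sure limit of
      \<open>x \<bullet> (l - b *\<^sub>R k n)\<close>. The limit variance is
      \<open>cov l l + (c\<^sup>2 - 2 * c / s) * (d \<bullet> l)\<^sup>2\<close>, whence the
      quadratic equation for \<open>c\<close>.\<close>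
    define b where "b = c * (d \<bullet> l)"
    define v where "v n = cov (l - b *\<^sub>R k n) (l - b *\<^sub>R k n)" for n
    have "(\<lambda>n. cov l l - 2 * b * cov l (k n) + b\<^sup>2 * cov (k n) (k n))
        \<longlonglongrightarrow> cov l l - 2 * b * ((d \<bullet> l) / s) + b\<^sup>2 * 1"
      by (intro tendsto_intros cl ckk)
    moreover have "v = (\<lambda>n. cov l l - 2 * b * cov l (k n) + b\<^sup>2 * cov (k n) (k n))"
      by (simp add: fun_eq_iff v_def cov_simps cov_commute[of "k _" l] power2_eq_square algebra_simps)
    moreover have "cov l l - 2 * b * ((d \<bullet> l) / s) + b\<^sup>2 * 1 = cov l l - (d \<bullet> l)\<^sup>2 / \<mu>\<^sup>2"
    proof -
      have "cov l l - 2 * b * ((d \<bullet> l) / s) + b\<^sup>2 * 1 = cov l l + (c\<^sup>2 - 2 * c / s) * (d \<bullet> l)\<^sup>2"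
        by (simp add: b_def power2_eq_square algebra_simps)
      then show ?thesis by (simp only: c) simp
    qed
    ultimately have v: "v \<longlonglongrightarrow> cov l l - (d \<bullet> l)\<^sup>2 / \<mu>\<^sup>2"
      by (simp only:)
    have "(\<lambda>n. CLINT x|N. iexp (x \<bullet> (l - b *\<^sub>R k n))) \<longlonglongrightarrow> (CLINT x|N. iexp (T x \<bullet> l))"
    proof (rule integral_dominated_convergence[where w="\<lambda>_. 1"])
      show "AE x in N. (\<lambda>n. iexp (x \<bullet> (l - b *\<^sub>R k n))) \<longlonglongrightarrow> iexp (T x \<bullet> l)"
        using conv
      proof eventually_elim
        case (elim x)
        then have "(\<lambda>n. x \<bullet> k n) \<longlonglongrightarrow> \<xi> x"
          by (simp add: \<xi>_def convergent_LIMSEQ_iff)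
        then have "(\<lambda>n. x \<bullet> l - b * (x \<bullet> k n)) \<longlonglongrightarrow> x \<bullet> l - b * \<xi> x"
          by (intro tendsto_intros)
        moreover have "T x \<bullet> l = x \<bullet> l - b * \<xi> x"
          by (simp add: T_def b_def inner_diff_left mult_ac)
        ultimately have "(\<lambda>n. x \<bullet> (l - b *\<^sub>R k n)) \<longlonglongrightarrow> T x \<bullet> l"
          by (simp add: inner_diff_right)
        then show ?case
          by (rule isCont_tendsto_compose[OF isCont_iexp])
      qed
    qed auto
    then have "(\<lambda>n. complex_of_real (exp (- v n / 2))) \<longlonglongrightarrow> (CLINT x|N. iexp (T x \<bullet> l))"
      unfolding charfun v_def .
    moreover have "(\<lambda>n. complex_of_real (exp (- v n / 2)))
        \<longlonglongrightarrow> complex_of_real (exp (- (cov l l - (d \<bullet> l)\<^sup>2 / \<mu>\<^sup>2) / 2))"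
      by (intro tendsto_intros v) simp
    ultimately have "(CLINT x|N. iexp (T x \<bullet> l))
        = complex_of_real (exp (- (cov l l - (d \<bullet> l)\<^sup>2 / \<mu>\<^sup>2) / 2))"
      by (rule LIMSEQ_unique)
    then show ?thesis
      by (subst integral_distr) auto
  qed
  moreover have "prob_space (distr N borel T)"
    by (rule prob_space_distr) measurable
  ultimately show ?thesis
    by (intro exI[of _ "distr N borel T"]) simp
qed

text \<open>Independence multiplies characteristic functionals, and the Gaussian factor of variance
  \<open>(d \<bullet> k)\<^sup>2 / \<mu>\<^sup>2\<close> restores exactly what \<open>W\<close>
  lacks.\<close>

lemma ex_gaussian_split:
  assumes "\<mu> > 0" and "\<And>k. cov k k \<le> 1 \<Longrightarrow> d \<bullet> k \<le> \<mu>"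
  obtains W where "prob_space W" "sets W = sets borel"
    "N = distr (normal_measure 0 \<Otimes>\<^sub>M W) borel (\<lambda>(x, w). (x / \<mu>) *\<^sub>R d + w)"
proof -
  obtain W where "prob_space W" and W [measurable_cong]: "sets W = sets borel"
    and cfW: "\<And>k. (CLINT w|W. iexp (w \<bullet> k)) = exp (- (cov k k - (d \<bullet> k)\<^sup>2 / \<mu>\<^sup>2) / 2)"
    using ex_complement_measure[OF assms] by blast
  interpret W: prob_space W by fact
  interpret S: prob_space "normal_measure 0"
    unfolding normal_measure_def by (rule prob_space_normal_density) simp
  interpret P: pair_prob_space "normal_measure 0" W ..
  have S_sets [measurable_cong]: "sets (normal_measure 0) = sets borel"
    by (simp add: normal_measure_def)
  let ?f = "\<lambda>(x, w). (x / \<mu>) *\<^sub>R d + w"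
  have f [measurable]: "?f \<in> borel_measurable (normal_measure 0 \<Otimes>\<^sub>M W)"
    by measurable
  have "N = distr (normal_measure 0 \<Otimes>\<^sub>M W) borel ?f"
  proof (rule finite_measure_eqI_charfun)
    show "finite_measure N" by (rule finite_measure_axioms)
    show "finite_measure (distr (normal_measure 0 \<Otimes>\<^sub>M W) borel ?f)"
      by (rule P.finite_measure_distr) measurable
    show "sets N = sets borel" by (rule sets_N)
    fix k
    let ?a = "(d \<bullet> k) / \<mu>"
    have "(CLINT x|distr (normal_measure 0 \<Otimes>\<^sub>M W) borel ?f. iexp (x \<bullet> k))
        = (CLINT p|(normal_measure 0 \<Otimes>\<^sub>M W). iexp (?a * fst p) * iexp (snd p \<bullet> k))"
      by (subst integral_distr)
        (auto intro!: Bochner_Integration.integral_cong simp: inner_add_left distrib_left exp_add mult_ac)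
    also have "\<dots> = (CLINT x|normal_measure 0. CLINT w|W. iexp (?a * x) * iexp (w \<bullet> k))"
    proof (subst P.integral_fst'[symmetric])
      show "integrable (normal_measure 0 \<Otimes>\<^sub>M W) (\<lambda>p. iexp (?a * fst p) * iexp (snd p \<bullet> k))"
        by (rule P.integrable_const_bound[of _ 1]) (auto simp: norm_mult)
    qed simp
    also have "\<dots> = (CLINT x|normal_measure 0. iexp (?a * x)) * (CLINT w|W. iexp (w \<bullet> k))"
      by simp
    also have "(CLINT x|normal_measure 0. iexp (?a * x)) = exp (- ?a\<^sup>2 / 2)"
      using char_centered_normal[of 1 ?a] by (simp add: char_def normal_measure_def)
    also have "complex_of_real (exp (- ?a\<^sup>2 / 2)) * (CLINT w|W. iexp (w \<bullet> k))
        = complex_of_real (exp (- ?a\<^sup>2 / 2 + - (cov k k - (d \<bullet> k)\<^sup>2 / \<mu>\<^sup>2) / 2))"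
      by (simp only: cfW exp_add of_real_mult)
    also have "- ?a\<^sup>2 / 2 + - (cov k k - (d \<bullet> k)\<^sup>2 / \<mu>\<^sup>2) / 2 = - cov k k / 2"
      by (simp add: power_divide field_simps)
    finally show "(CLINT x|N. iexp (x \<bullet> k))
        = (CLINT x|distr (normal_measure 0 \<Otimes>\<^sub>M W) borel ?f. iexp (x \<bullet> k))"
      by (simp only: charfun)
  qed simp
  then show ?thesis
    using that \<open>prob_space W\<close> W by blast
qed

end

subsection \<open>Trade-off functions\<close>

lemma prob_space_normal_measure: "prob_space (normal_measure m)"
  unfolding normal_measure_def by (rule prob_space_normal_density) simp

lemma sets_normal_measure [measurable_cong, simp]: "sets (normal_measure m) = sets borel"
  by (simp add: normal_measure_def)

lemma normal_measure_shift:
  "normal_measure m = distr (normal_measure 0) borel (\<lambda>x. x + m)"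
proof -
  interpret prob_space "normal_measure 0"
    by (rule prob_space_normal_measure)
  have "distributed (normal_measure 0) lborel (\<lambda>x. m + 1 * x) (normal_density (m + 1 * 0) (\<bar>1\<bar> * 1))"
    by (intro normal_density_affine) (auto simp: distributed_def distr_id2 normal_measure_def)
  then show ?thesis
    by (simp add: distributed_def normal_measure_def add.commute cong: distr_cong)
qed

text \<open>More tests give a smaller infimum: when every test for the \<open>U\<close> pair is
  matched in both errors by one for the \<open>V\<close> pair, the \<open>V\<close> pair is at least
  as easy to tell apart. \<open>Inf\<close> on the reals also requires a nonempty set (the test 0)
  and a lower bound.\<close>

lemma tradeoff_mono:
  fixes U1 U2 :: "'b measure" and V1 V2 :: "'c measure"
  assumes V2: "prob_space V2" and "0 \<le> \<alpha>"
    and tests: "\<And>\<phi> :: 'b \<Rightarrow> real. \<phi> \<in> borel_measurable U1 \<Longrightarrow> (\<And>x. 0 \<le> \<phi> x \<and> \<phi> x \<le> 1) \<Longrightarrow>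
      \<exists>\<psi> :: 'c \<Rightarrow> real. \<psi> \<in> borel_measurable V1 \<and> (\<forall>x. 0 \<le> \<psi> x \<and> \<psi> x \<le> 1) \<and>
        (\<integral>x. \<psi> x \<partial>V1) = (\<integral>x. \<phi> x \<partial>U1) \<and> (\<integral>x. \<psi> x \<partial>V2) = (\<integral>x. \<phi> x \<partial>U2)"
  shows "tradeoff V1 V2 \<alpha> \<le> tradeoff U1 U2 \<alpha>"
  unfolding tradeoff_def
proof (rule cInf_superset_mono)
  interpret V2: prob_space V2 by fact
  show "{1 - (\<integral>x. \<phi> x \<partial>U2) | \<phi>. \<phi> \<in> borel_measurable U1 \<and> (\<forall>x. 0 \<le> \<phi> x \<and> \<phi> x \<le> 1) \<and> (\<integral>x. \<phi> x \<partial>U1) \<le> \<alpha>} \<noteq> {}"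
    using \<open>0 \<le> \<alpha>\<close> by (auto intro!: exI[of _ "\<lambda>_. 0"])
  \<comment> \<open>Tests are measurable for \<open>V1\<close> only; if one is not integrable for
    \<open>V2\<close>, its integral is 0 by convention and the bound persists.\<close>
  have "0 \<le> 1 - (\<integral>x. \<psi> x \<partial>V2)" if "\<forall>x. 0 \<le> \<psi> x \<and> \<psi> x \<le> 1" for \<psi> :: "'c \<Rightarrow> real"
  proof (cases "integrable V2 \<psi>")
    case True
    then have "(\<integral>x. \<psi> x \<partial>V2) \<le> (\<integral>x. 1 \<partial>V2)"
      using that by (intro integral_mono) auto
    then show ?thesis by (simp add: V2.prob_space)
  qed (simp add: not_integrable_integral_eq)
  then show "bdd_below {1 - (\<integral>x. \<phi> x \<partial>V2) | \<phi>. \<phi> \<in> borel_measurable V1 \<and> (\<forall>x. 0 \<le> \<phi> x \<and> \<phi> x \<le> 1) \<and> (\<integral>x. \<phi> x \<partial>V1) \<le> \<alpha>}"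
    by (intro bdd_belowI[of _ 0]) auto
  show "{1 - (\<integral>x. \<phi> x \<partial>U2) | \<phi>. \<phi> \<in> borel_measurable U1 \<and> (\<forall>x. 0 \<le> \<phi> x \<and> \<phi> x \<le> 1) \<and> (\<integral>x. \<phi> x \<partial>U1) \<le> \<alpha>}
    \<subseteq> {1 - (\<integral>x. \<phi> x \<partial>V2) | \<phi>. \<phi> \<in> borel_measurable V1 \<and> (\<forall>x. 0 \<le> \<phi> x \<and> \<phi> x \<le> 1) \<and> (\<integral>x. \<phi> x \<partial>V1) \<le> \<alpha>}"
  proof safe
    fix \<phi> :: "'b \<Rightarrow> real" assume \<phi>: "\<phi> \<in> borel_measurable U1" "\<forall>x. 0 \<le> \<phi> x \<and> \<phi> x \<le> 1" "(\<integral>x. \<phi> x \<partial>U1) \<le> \<alpha>"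
    obtain \<psi> where "\<psi> \<in> borel_measurable V1" "\<forall>x. 0 \<le> \<psi> x \<and> \<psi> x \<le> 1"
      "(\<integral>x. \<psi> x \<partial>V1) = (\<integral>x. \<phi> x \<partial>U1)" "(\<integral>x. \<psi> x \<partial>V2) = (\<integral>x. \<phi> x \<partial>U2)"
      using tests[of \<phi>] \<phi> by blast
    with \<phi>(3) show "\<exists>\<psi>. 1 - (\<integral>x. \<phi> x \<partial>U2) = 1 - (\<integral>x. \<psi> x \<partial>V2) \<and> \<psi> \<in> borel_measurable V1
        \<and> (\<forall>x. 0 \<le> \<psi> x \<and> \<psi> x \<le> 1) \<and> (\<integral>x. \<psi> x \<partial>V1) \<le> \<alpha>"
      by (intro exI[of _ \<psi>]) simp
  qed
qed

text \<open>A test of \<open>U\<close> against itself has power equal to its size, and so does the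
  constant test with that value under any two hypotheses.\<close>

lemma G_le_tradeoff_same:
  assumes U: "prob_space U" and "0 \<le> \<alpha>"
  shows "G \<mu> \<alpha> \<le> tradeoff U U \<alpha>"
  unfolding G_def
proof (rule tradeoff_mono[OF prob_space_normal_measure \<open>0 \<le> \<alpha>\<close>])
  interpret U: prob_space U by fact
  fix \<phi> :: "'a \<Rightarrow> real"
  assume [measurable]: "\<phi> \<in> borel_measurable U" and \<phi>: "\<And>x. 0 \<le> \<phi> x \<and> \<phi> x \<le> 1"
  have int: "integrable U \<phi>"
    using \<phi> by (intro U.integrable_const_bound[of _ 1]) auto
  have "0 \<le> (\<integral>x. \<phi> x \<partial>U)" "(\<integral>x. \<phi> x \<partial>U) \<le> 1"
    using \<phi> int by (auto intro!: Bochner_Integration.integral_nonneg U.integral_le_const)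
  then show "\<exists>\<psi>. \<psi> \<in> borel_measurable (normal_measure 0) \<and> (\<forall>x. 0 \<le> \<psi> x \<and> \<psi> x \<le> 1) \<and>
      (\<integral>x. \<psi> x \<partial>normal_measure 0) = (\<integral>x. \<phi> x \<partial>U) \<and>
      (\<integral>x. \<psi> x \<partial>normal_measure \<mu>) = (\<integral>x. \<phi> x \<partial>U)"
    using prob_space.prob_space[OF prob_space_normal_measure]
    by (intro exI[of _ "\<lambda>_. \<integral>x. \<phi> x \<partial>U"]) simp
qed

section \<open>Trade-off bound for shifted Gaussian measures\<close>

context centered_gaussian
begin

lemma tradeoff_shift_ge:
  fixes a b :: 'a
  assumes "\<mu> > 0" "\<sigma> > 0" and bdd: "\<And>k. cov k k \<le> 1 \<Longrightarrow> (b - a) \<bullet> k \<le> \<sigma> * \<mu>"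
    and "0 \<le> \<alpha>"
  shows "G \<mu> \<alpha> \<le> tradeoff (distr N borel (\<lambda>x. a + \<sigma> *\<^sub>R x)) (distr N borel (\<lambda>x. b + \<sigma> *\<^sub>R x)) \<alpha>"
  unfolding G_def
proof (rule tradeoff_mono[OF prob_space_normal_measure \<open>0 \<le> \<alpha>\<close>])
  define d where "d = (1 / \<sigma>) *\<^sub>R (b - a)"
  have "d \<bullet> k \<le> \<mu>" if "cov k k \<le> 1" for k
    using bdd[OF that] \<open>\<sigma> > 0\<close> by (simp add: d_def divide_le_eq mult.commute)
  then obtain W where "prob_space W" and W [measurable_cong]: "sets W = sets borel"
    and N: "N = distr (normal_measure 0 \<Otimes>\<^sub>M W) borel (\<lambda>(x, w). (x / \<mu>) *\<^sub>R d + w)"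
    using ex_gaussian_split[OF \<open>\<mu> > 0\<close>, of d] by blast
  interpret W: prob_space W by fact
  interpret S: prob_space "normal_measure 0" by (rule prob_space_normal_measure)
  interpret P: pair_prob_space "normal_measure 0" W ..
  fix \<phi> :: "'a \<Rightarrow> real"
  assume "\<phi> \<in> borel_measurable (distr N borel (\<lambda>x. a + \<sigma> *\<^sub>R x))" and \<phi>: "\<And>x. 0 \<le> \<phi> x \<and> \<phi> x \<le> 1"
  then have [measurable]: "\<phi> \<in> borel_measurable borel" by simp
  define \<psi> where "\<psi> x = (\<integral>w. \<phi> (a + \<sigma> *\<^sub>R ((x / \<mu>) *\<^sub>R d + w)) \<partial>W)" for x
  have [measurable]: "\<psi> \<in> borel_measurable borel"
    unfolding \<psi>_def by measurable
  have int: "integrable W (\<lambda>w. \<phi> (f w))" if [measurable]: "f \<in> borel_measurable borel" for f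
    using \<phi> by (intro W.integrable_const_bound[of _ 1]) auto
  have \<psi>01: "0 \<le> \<psi> x \<and> \<psi> x \<le> 1" for x
  proof
    show "0 \<le> \<psi> x"
      unfolding \<psi>_def using \<phi> by (intro Bochner_Integration.integral_nonneg) auto
    show "\<psi> x \<le> 1"
      unfolding \<psi>_def using \<phi> by (intro W.integral_le_const int) auto
  qed
  \<comment> \<open>Fubini with a free shift \<open>m\<close> treats both hypotheses at once:
    \<open>m = 0\<close> leaves the location \<open>a\<close>, and \<open>m = \<mu>\<close> moves it
    to \<open>b\<close>.\<close>
  have shift: "(\<integral>x. \<psi> (x + m) \<partial>normal_measure 0) = (\<integral>x. \<phi> x \<partial>distr N borel (\<lambda>x. (a + (\<sigma> * m / \<mu>) *\<^sub>R d) + \<sigma> *\<^sub>R x))" for m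
  proof -
    have "(\<integral>x. \<phi> x \<partial>distr N borel (\<lambda>x. (a + (\<sigma> * m / \<mu>) *\<^sub>R d) + \<sigma> *\<^sub>R x))
        = (\<integral>p. \<phi> (a + \<sigma> *\<^sub>R (((fst p + m) / \<mu>) *\<^sub>R d + snd p)) \<partial>(normal_measure 0 \<Otimes>\<^sub>M W))"
    proof (subst integral_distr)
      show "(\<integral>x. \<phi> ((a + (\<sigma> * m / \<mu>) *\<^sub>R d) + \<sigma> *\<^sub>R x) \<partial>N)
        = (\<integral>p. \<phi> (a + \<sigma> *\<^sub>R (((fst p + m) / \<mu>) *\<^sub>R d + snd p)) \<partial>(normal_measure 0 \<Otimes>\<^sub>M W))"
        by (subst N, subst integral_distr)
          (auto intro!: Bochner_Integration.integral_cong arg_cong[where f=\<phi>]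
            simp: algebra_simps add_divide_distrib)
    qed measurable
    also have "\<dots> = (\<integral>x. \<psi> (x + m) \<partial>normal_measure 0)"
      unfolding \<psi>_def
    proof (subst P.integral_fst'[symmetric])
      show "integrable (normal_measure 0 \<Otimes>\<^sub>M W) (\<lambda>p. \<phi> (a + \<sigma> *\<^sub>R (((fst p + m) / \<mu>) *\<^sub>R d + snd p)))"
        using \<phi> by (intro P.integrable_const_bound[of _ 1]) auto
    qed simp
    finally show ?thesis ..
  qed
  have "a + (\<sigma> * \<mu> / \<mu>) *\<^sub>R d = b"
    using \<open>\<mu> > 0\<close> \<open>\<sigma> > 0\<close> by (simp add: d_def)
  then have "(\<integral>x. \<psi> x \<partial>normal_measure \<mu>) = (\<integral>x. \<phi> x \<partial>distr N borel (\<lambda>x. b + \<sigma> *\<^sub>R x))"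
    using shift[of \<mu>] by (subst normal_measure_shift, subst integral_distr) auto
  moreover have "(\<integral>x. \<psi> x \<partial>normal_measure 0) = (\<integral>x. \<phi> x \<partial>distr N borel (\<lambda>x. a + \<sigma> *\<^sub>R x))"
    using shift[of 0] by simp
  ultimately show "\<exists>\<psi>. \<psi> \<in> borel_measurable (normal_measure 0) \<and> (\<forall>x. 0 \<le> \<psi> x \<and> \<psi> x \<le> 1) \<and>
      (\<integral>x. \<psi> x \<partial>normal_measure 0) = (\<integral>x. \<phi> x \<partial>distr N borel (\<lambda>x. a + \<sigma> *\<^sub>R x)) \<and>
      (\<integral>x. \<psi> x \<partial>normal_measure \<mu>) = (\<integral>x. \<phi> x \<partial>distr N borel (\<lambda>x. b + \<sigma> *\<^sub>R x))"
    using \<psi>01 by (intro exI[of _ \<psi>]) auto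
qed

lemma cm_set_eq: "cm_set N h = {h \<bullet> k | k. cov k k \<le> 1}"
  by (simp add: cm_set_def cov_eq_square)

text \<open>The unit ball of \<open>cov\<close> is symmetric, so the bound for \<open>h\<close> at
  \<open>- k\<close> handles the minus sign. Boundedness makes \<open>cm_norm\<close> of a
  difference a genuine supremum.\<close>

lemma bdd_above_cm_set_diff:
  assumes "g \<in> cameron_martin_space N" "h \<in> cameron_martin_space N"
  shows "bdd_above (cm_set N (g - h))"
proof -
  obtain A B where A: "\<And>k. cov k k \<le> 1 \<Longrightarrow> g \<bullet> k \<le> A" and B: "\<And>k. cov k k \<le> 1 \<Longrightarrow> h \<bullet> k \<le> B"
    using assms unfolding cameron_martin_space_def cm_set_eq bdd_above_def by fast
  have "(g - h) \<bullet> k \<le> A + B" if "cov k k \<le> 1" for k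
  proof -
    have "cov (- k) (- k) \<le> 1"
      using that cov_scaleR_left[of "-1" k "- k"] cov_scaleR_right[of k "-1" k] by simp
    from B[OF this] A[OF that] show ?thesis
      by (simp add: inner_diff_left)
  qed
  then show ?thesis
    unfolding cm_set_eq by (intro bdd_aboveI[of _ "A + B"]) auto
qed

end

theorem theorem1:
  fixes M :: "'w measure" and Z :: "'w \<Rightarrow> 'a::{real_inner,polish_space}"
    and h :: "'x list \<Rightarrow> 'a" and n :: nat and \<mu> \<sigma> :: real
  assumes "prob_space M"
    and "Z \<in> borel_measurable M"
    and "centered_gaussian_measure (distr M borel Z)"
    and "\<And>D. length D = n \<Longrightarrow> h D \<in> cameron_martin_space (distr M borel Z)"
    and "bdd_above {cm_norm (distr M borel Z) (h D - h D') | D D'. adjacent n D D'}"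
    and "\<mu> > 0"
    and "\<sigma> \<ge> Sup {cm_norm (distr M borel Z) (h D - h D') | D D'. adjacent n D D'} / \<mu>"
  shows "GDP \<mu> (adjacent n) (\<lambda>D. distr M borel (\<lambda>w. h D + \<sigma> *\<^sub>R Z w))"
proof -
  let ?N = "distr M borel Z"
  interpret M: prob_space M by fact
  note [measurable] = assms(2)
  interpret N: centered_gaussian ?N
    by unfold_locales (rule assms(3))
  have mech: "distr M borel (\<lambda>w. c + \<sigma> *\<^sub>R Z w) = distr ?N borel (\<lambda>x. c + \<sigma> *\<^sub>R x)" for c
    by (subst distr_distr) (auto simp: comp_def)
  have sens: "(h D' - h D) \<bullet> k \<le> \<sigma> * \<mu>" if adj: "adjacent n D D'" and k: "N.cov k k \<le> 1" for D D' k
  proof -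
    let ?A = "{cm_norm ?N (h D - h D') | D D'. adjacent n D D'}"
    \<comment> \<open>Passing from \<open>D\<close> to \<open>D'\<close> shifts by
      \<open>h D' - h D\<close>, whose norm enters the sensitivity through the swapped pair.\<close>
    have "adjacent n D' D"
      using adj by (simp add: adjacent_def eq_commute)
    then have "cm_norm ?N (h D' - h D) \<le> Sup ?A"
      by (intro cSup_upper assms(5)) blast
    moreover have "(h D' - h D) \<bullet> k \<le> cm_norm ?N (h D' - h D)"
      unfolding cm_norm_def
      using adj k by (intro cSup_upper N.bdd_above_cm_set_diff assms(4)) (auto simp: N.cm_set_eq adjacent_def)
    moreover have "Sup ?A \<le> \<sigma> * \<mu>"
      using assms(6,7) by (simp add: divide_le_eq)
    ultimately show ?thesis by linarith
  qed
  have "G \<mu> \<alpha> \<le> tradeoff (distr M borel (\<lambda>w. h D + \<sigma> *\<^sub>R Z w)) (distr M borel (\<lambda>w. h D' + \<sigma> *\<^sub>R Z w)) \<alpha>"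
    if adj: "adjacent n D D'" and \<alpha>: "0 \<le> \<alpha>" "\<alpha> \<le> 1" for D D' \<alpha>
  proof -
    \<comment> \<open>The sign of \<open>\<sigma>\<close> comes from the adjacent pair at hand; with
      no such pair the supremum is over the empty set, but the privacy claim is vacuous.\<close>
    have "0 \<le> \<sigma> * \<mu>"
      using sens[OF adj, of 0] by (simp add: N.cov_def)
    then consider "\<sigma> > 0" | "\<sigma> = 0"
      using assms(6) by (cases "\<sigma> = 0") (auto simp: zero_le_mult_iff)
    then show ?thesis
    proof cases
      case 1
      then show ?thesis
        unfolding mech using assms(6) sens[OF adj] \<alpha> by (intro N.tradeoff_shift_ge) auto
    next
      case 2
      \<comment> \<open>With bound 0 the Cauchy-Schwarz estimate, taken in the direction
        \<open>h D' - h D\<close> itself, forces this difference to vanish.\<close>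
      have "((h D' - h D) \<bullet> (h D' - h D))\<^sup>2 \<le> 0\<^sup>2 * N.cov (h D' - h D) (h D' - h D)"
        using sens[OF adj] 2 by (intro N.inner_square_le_cov) simp
      then have "h D' = h D" by simp
      then show ?thesis
        using \<alpha> by (auto intro!: G_le_tradeoff_same M.prob_space_distr)
    qed
  qed
  then show ?thesis
    by (auto simp: GDP_def)
qed

end
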